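(* Let $(\mathcal{X},d)$ be a metric space, let $f,g:\mathcal{X}\to\mathcal{X}$ be maps and $F,G:\mathcal{X}\to\mathcal{P}_{fb}(\mathcal{X})$ be set-valued maps such that the pairs $\{f,F\}$ and $\{g,G\}$ are occasionally weakly compatible. Let $\varphi:(\mathbb{R}^+)^6\to\mathbb{R}$ be a function, written $\varphi(t_1,\dots,t_6)$, such that: (i) $\varphi$ is nonincreasing in the variables $t_5$ and $t_6$; (ii) for every $t'\in\mathbb{R}^+$, $\varphi(t',t,0,0,t,t)\ge 0$ for all $t>0$. Suppose that for all $x,y\in\mathcal{X}$ for which $\max\{d(fx,gy),d(fx,Fx),d(gy,Gy)\}>0$, $$\varphi\big(H(Fx,Gy),\,d(fx,gy),\,d(fx,Fx),\,d(gy,Gy),\,d(fx,Gy),\,d(gy,Fx)\big)<0 .$$ Then $f$, $g$, $F$ and $G$ have a unique common fixed point.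
   Context: $\mathcal{P}_{fb}(\mathcal{X})$ is the class of all nonempty bounded closed subsets of $\mathcal{X}$. $\mathbb{R}^+=[0,\infty)$. We write $fx=f(x)$, $Fx=F(x)$, and for $x\in\mathcal{X}$, $A\subseteq\mathcal{X}$, $d(x,A)=\inf\{d(x,y):y\in A\}$. $H$ is the Hausdorff metric on $\mathcal{P}_{fb}(\mathcal{X})$: $H(A,B)=\max\{\sup_{x\in A}d(x,B),\sup_{y\in B}d(y,A)\}$. A pair $\{f,F\}$ with $f:\mathcal{X}\to\mathcal{X}$ and $F:\mathcal{X}\to\mathcal{P}_{fb}(\mathcal{X})$ is occasionally weakly compatible (owc) if there exists $x\in\mathcal{X}$ such that $fx\in Fx$ and $fFx\subseteq Ffx$, where $fFx=\{f(y):y\in F(x)\}$ and $Ffx=F(f(x))$. A common fixed point of $f,g,F,G$ is a point $w\in\mathcal{X}$ with $w=fw=gw$, $w\in Fw$ and $w\in Gw$. *)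

theory Defs
  imports "HOL-Analysis.Analysis"
begin

definition Pfb :: "'a::metric_space set set" where
  "Pfb = {A. A \<noteq> {} \<and> bounded A \<and> closed A}"

text \<open>The point-to-set distance \<open>d(x,A)\<close> is the library's \<^const>\<open>infdist\<close>. On \<open>Pfb\<close> all sets are
  nonempty and bounded, so the suprema below are suprema of nonempty, bounded sets of reals.\<close>

definition hausdorff :: "'a::metric_space set \<Rightarrow> 'a set \<Rightarrow> real" where
  "hausdorff A B = max (SUP x\<in>A. infdist x B) (SUP y\<in>B. infdist y A)"

definition owc :: "('a \<Rightarrow> 'a) \<Rightarrow> ('a \<Rightarrow> 'a set) \<Rightarrow> bool" where
  "owc f F \<longleftrightarrow> (\<exists>x. f x \<in> F x \<and> f ` F x \<subseteq> F (f x))"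

definition common_fixed_point ::
  "('a \<Rightarrow> 'a) \<Rightarrow> ('a \<Rightarrow> 'a) \<Rightarrow> ('a \<Rightarrow> 'a set) \<Rightarrow> ('a \<Rightarrow> 'a set) \<Rightarrow> 'a \<Rightarrow> bool" where
  "common_fixed_point f g F G w \<longleftrightarrow> w = f w \<and> w = g w \<and> w \<in> F w \<and> w \<in> G w"

text \<open>A function on \<open>[0,\<infinity>)\<^sup>6\<close> is represented by a total curried function on the reals;
  only its values at nonnegative arguments are ever constrained.\<close>

definition nonincreasing_5_6 ::
  "(real \<Rightarrow> real \<Rightarrow> real \<Rightarrow> real \<Rightarrow> real \<Rightarrow> real \<Rightarrow> real) \<Rightarrow> bool" where
  "nonincreasing_5_6 \<phi> \<longleftrightarrow>
    (\<forall>t1\<ge>0. \<forall>t2\<ge>0. \<forall>t3\<ge>0. \<forall>t4\<ge>0.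
       (\<forall>t6\<ge>0. antimono_on {0..} (\<lambda>t5. \<phi> t1 t2 t3 t4 t5 t6)) \<and>
       (\<forall>t5\<ge>0. antimono_on {0..} (\<lambda>t6. \<phi> t1 t2 t3 t4 t5 t6)))"

end

theory Submission
  imports Defs
begin

text \<open>
  If \<open>f x \<in> F x\<close> and \<open>g y \<in> G y\<close>, then \<open>d(fx,gy)\<close> dominates \<open>d(fx,Gy)\<close> and \<open>d(gy,Fx)\<close>, so the
  contraction condition and (i) would contradict (ii) unless \<open>f x = g y\<close>. Occasional weak
  compatibility makes \<open>f x\<close> a coincidence point of \<open>{f,F}\<close> as soon as \<open>x\<close> is, whence
  \<open>f (f x) = g y = f x\<close>, and symmetrically for \<open>g\<close>.
\<close>

lemma bdd_above_infdist_image: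
  assumes "bounded A" "B \<noteq> {}"
  shows "bdd_above ((\<lambda>x. infdist x B) ` A)"
proof -
  obtain b where b: "b \<in> B" using assms(2) by blast
  obtain e where "\<And>x. x \<in> A \<Longrightarrow> dist b x \<le> e"
    using assms(1) bounded_any_center[of A b] by blast
  then have "infdist x B \<le> e" if "x \<in> A" for x
    using infdist_le[OF b, of x] that by (fastforce simp: dist_commute)
  then show ?thesis by (rule bdd_above.I2)
qed

text \<open>Lets \<open>hausdorff\<close> serve as the \<open>t'\<close> of condition (ii), which
  must be nonnegative. A real \<open>SUP\<close> is sure to dominate its members only when they are
  bounded above; hence the boundedness lemma.\<close>

lemma hausdorff_nonneg:
  assumes "A \<in> Pfb" "B \<in> Pfb"
  shows "0 \<le> hausdorff A B"
proof -
  obtain a where "a \<in> A" using assms(1) by (auto simp: Pfb_def)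
  moreover have "bdd_above ((\<lambda>x. infdist x B) ` A)"
    using assms by (intro bdd_above_infdist_image) (auto simp: Pfb_def)
  ultimately have "0 \<le> (SUP x\<in>A. infdist x B)"
    by (metis cSUP_upper2 infdist_nonneg)
  then show ?thesis by (simp add: hausdorff_def)
qed

lemma nonincreasing_5_6D:
  assumes "nonincreasing_5_6 \<phi>" "0 \<le> t1" "0 \<le> t2" "0 \<le> t3" "0 \<le> t4"
    and "0 \<le> s5" "s5 \<le> t5" "0 \<le> s6" "s6 \<le> t6"
  shows "\<phi> t1 t2 t3 t4 t5 t6 \<le> \<phi> t1 t2 t3 t4 s5 s6"
proof -
  have a: "antimono_on {0..} (\<lambda>u. \<phi> t1 t2 t3 t4 u t6)"
    and b: "antimono_on {0..} (\<lambda>u. \<phi> t1 t2 t3 t4 s5 u)"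
    using assms unfolding nonincreasing_5_6_def by auto
  have "\<phi> t1 t2 t3 t4 t5 t6 \<le> \<phi> t1 t2 t3 t4 s5 t6"
    using assms by (intro monotone_onD[OF a]) auto
  also have "\<dots> \<le> \<phi> t1 t2 t3 t4 s5 s6"
    using assms by (intro monotone_onD[OF b]) auto
  finally show ?thesis .
qed

text \<open>Applying the inclusion to the element \<open>f x\<close> of \<open>F x\<close> shows
  that \<open>f x\<close> is again a coincidence point.\<close>

lemma owcE:
  assumes "owc f F"
  obtains x where "f x \<in> F x" "f (f x) \<in> F (f x)"
  using assms by (auto simp: owc_def)

theorem theorem2p3:
  fixes f g :: "'a::metric_space \<Rightarrow> 'a"
    and F G :: "'a \<Rightarrow> 'a set"
    and \<phi> :: "real \<Rightarrow> real \<Rightarrow> real \<Rightarrow> real \<Rightarrow> real \<Rightarrow> real \<Rightarrow> real"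
  assumes F: "\<And>x. F x \<in> Pfb"
    and G: "\<And>x. G x \<in> Pfb"
    and "owc f F"
    and "owc g G"
    and mono: "nonincreasing_5_6 \<phi>"
    and nonneg: "\<And>t' t. t' \<ge> 0 \<Longrightarrow> t > 0 \<Longrightarrow> \<phi> t' t 0 0 t t \<ge> 0"
    and contr: "\<And>x y. max (dist (f x) (g y)) (max (infdist (f x) (F x)) (infdist (g y) (G y))) > 0 \<Longrightarrow>
      \<phi> (hausdorff (F x) (G y)) (dist (f x) (g y)) (infdist (f x) (F x)) (infdist (g y) (G y))
        (infdist (f x) (G y)) (infdist (g y) (F x)) < 0"
  shows "\<exists>!w. common_fixed_point f g F G w"
proof -
  have coincidence: "f x = g y" if x: "f x \<in> F x" and y: "g y \<in> G y" for x y
  proof (rule ccontr)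
    let ?t = "dist (f x) (g y)" and ?h = "hausdorff (F x) (G y)"
    assume "f x \<noteq> g y"
    then have t: "?t > 0" by simp
    have h: "0 \<le> ?h" by (intro hausdorff_nonneg F G)
    have "\<phi> ?h ?t 0 0 ?t ?t \<le> \<phi> ?h ?t 0 0 (infdist (f x) (G y)) (infdist (g y) (F x))"
      using infdist_le[OF y, of "f x"] infdist_le[OF x, of "g y"]
      by (intro nonincreasing_5_6D[OF mono] h)
        (auto simp: infdist_nonneg dist_commute)
    \<comment> \<open>The memberships \<open>x\<close> and \<open>y\<close> make the third and
      fourth arguments of \<open>contr\<close> vanish, and \<open>?t > 0\<close> meets its
      premise.\<close>
    also have "\<dots> < 0"
      using contr[of x y] t x y by simp
    finally show False using nonneg[OF h t] by simp
  qed
  obtain x where x: "f x \<in> F x" "f (f x) \<in> F (f x)"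
    using \<open>owc f F\<close> by (rule owcE)
  obtain y where y: "g y \<in> G y" "g (g y) \<in> G (g y)"
    using \<open>owc g G\<close> by (rule owcE)
  \<comment> \<open>\<open>coincidence\<close> at the pairs \<open>(x, y)\<close>,
    \<open>(f x, y)\<close> and \<open>(x, g y)\<close>.\<close>
  have "f x = g y" "f (f x) = g y" "f x = g (g y)"
    using coincidence x y by blast+
  then have "common_fixed_point f g F G (f x)"
    using x y by (simp add: common_fixed_point_def)
  \<comment> \<open>Here \<open>v = f v = g w = w\<close>.\<close>
  moreover have "v = w" if "common_fixed_point f g F G v" "common_fixed_point f g F G w" for v w
    using that coincidence[of v w] by (simp add: common_fixed_point_def)
  ultimately show ?thesis by blast
qed

end
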